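(* Let $A\in\mathbb{R}^{N\times N}$, $N=m+pn$, be a symmetric positive definite $B^3$-Arrowhead matrix with block-bandwidths $(\ell,\ell)$ and sub-block-bandwidth $\lambda+\mu$. Then the reverse Cholesky factorisation $A=L^\top L$ ($L$ lower triangular) can be computed in $O(N)$ operations, and, once it has been computed, its inverse can be applied to a vector (i.e. linear systems can be solved with the factorisation) in $O(N)$ operations. Here the implied constants depend only on $\ell,\lambda,\mu$ (and not on $m,n,p$).
   Context: "Operations" are real arithmetic operations (including square roots), in exact arithmetic. A (possibly rectangular) matrix $M=(M_{kj})$ is banded with bandwidths $(l,u)$ if $M_{kj}=0$ whenever $k-j>l$ or $j-k>u$. A block matrix is block-banded with block-bandwidths $(l,u)$ if its $(K,J)$ block is zero whenever $K-J>l$ or $J-K>u$. A Banded-Block-Banded-Arrowhead ($B^3$-Arrowhead) matrix $A\in\mathbb{R}^{(m+pn)\times(m+pn)}$ with block-bandwidths $(\ell,u)$ and sub-block-bandwidth $\lambda+\mu$ is a matrix partitioned into blocks, with one first block of size $m$ followed by $p$ blocks of size $n$ (in both rows and columns), such that: 1. it is block-banded with block-bandwidths $(\ell,u)$; 2. the top-left block $A_0\in\mathbb{R}^{m\times m}$ is banded with bandwidths $(\lambda+\mu,\lambda+\mu)$; 3. the remaining blocks in the first block row, $B_k\in\mathbb{R}^{m\times n}$, have bandwidths $(\lambda,\mu)$; 4. the remaining blocks in the first block column, $C_k\in\mathbb{R}^{n\times m}$, have bandwidths $(\mu,\lambda)$; 5. all other blocks $D_{k,j}\in\mathbb{R}^{n\times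 n}$ are diagonal. The structure (block sizes and bandwidths) of the matrix is known and only its structurally nonzero entries are stored and operated on. *)

theory Defs
  imports Complex_Main "Jordan_Normal_Form.Matrix"
begin

section \<open>Banded-Block-Banded-Arrowhead matrices\<close>

definition banded :: "nat \<Rightarrow> nat \<Rightarrow> real mat \<Rightarrow> bool" where
  "banded l u M \<longleftrightarrow> (\<forall>k<dim_row M. \<forall>j<dim_col M.
     int k - int j > int l \<or> int j - int k > int u \<longrightarrow> M $$ (k, j) = 0)"

text \<open>Block indices run over \<open>0, \<dots>, p\<close>; block 0 has size \<open>m\<close>, the others have size \<open>n\<close>.\<close>

definition block_size :: "nat \<Rightarrow> nat \<Rightarrow> nat \<Rightarrow> nat" where
  "block_size m n K = (if K = 0 then m else n)"

definition block_start :: "nat \<Rightarrow> nat \<Rightarrow> nat \<Rightarrow> nat" where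
  "block_start m n K = (\<Sum>J<K. block_size m n J)"

definition block :: "nat \<Rightarrow> nat \<Rightarrow> real mat \<Rightarrow> nat \<Rightarrow> nat \<Rightarrow> real mat" where
  "block m n A K J = mat (block_size m n K) (block_size m n J)
     (\<lambda>(i, j). A $$ (block_start m n K + i, block_start m n J + j))"

definition block_banded :: "nat \<Rightarrow> nat \<Rightarrow> nat \<Rightarrow> nat \<Rightarrow> nat \<Rightarrow> real mat \<Rightarrow> bool" where
  "block_banded m n p l u A \<longleftrightarrow> (\<forall>K\<le>p. \<forall>J\<le>p.
     int K - int J > int l \<or> int J - int K > int u \<longrightarrow>
       block m n A K J = 0\<^sub>m (block_size m n K) (block_size m n J))"

definition B3_arrowhead ::
    "nat \<Rightarrow> nat \<Rightarrow> nat \<Rightarrow> nat \<Rightarrow> nat \<Rightarrow> nat \<Rightarrow> nat \<Rightarrow> real mat \<Rightarrow> bool" where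
  "B3_arrowhead m n p l u lam mu A \<longleftrightarrow>
     A \<in> carrier_mat (m + p * n) (m + p * n) \<and>
     block_banded m n p l u A \<and>
     banded (lam + mu) (lam + mu) (block m n A 0 0) \<and>
     (\<forall>k\<in>{1..p}. banded lam mu (block m n A 0 k)) \<and>
     (\<forall>k\<in>{1..p}. banded mu lam (block m n A k 0)) \<and>
     (\<forall>k\<in>{1..p}. \<forall>j\<in>{1..p}. diagonal_mat (block m n A k j))"

text \<open>A position is structurally nonzero if the structure does not force the entry there to vanish.\<close>

definition structural_nonzeros ::
    "nat \<Rightarrow> nat \<Rightarrow> nat \<Rightarrow> nat \<Rightarrow> nat \<Rightarrow> nat \<Rightarrow> nat \<Rightarrow> (nat \<times> nat) set" where
  "structural_nonzeros m n p l u lam mu =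
     {(i, j). i < m + p * n \<and> j < m + p * n \<and>
        (\<exists>A. B3_arrowhead m n p l u lam mu A \<and> A $$ (i, j) \<noteq> 0)}"

section \<open>Reverse Cholesky factorisation\<close>

definition symmetric_positive_definite :: "real mat \<Rightarrow> bool" where
  "symmetric_positive_definite A \<longleftrightarrow>
     square_mat A \<and> A\<^sup>T = A \<and>
     (\<forall>v\<in>carrier_vec (dim_row A). v \<noteq> 0\<^sub>v (dim_row A) \<longrightarrow> v \<bullet> (A *\<^sub>v v) > 0)"

definition lower_triangular :: "real mat \<Rightarrow> bool" where
  "lower_triangular L \<longleftrightarrow> (\<forall>i<dim_row L. \<forall>j<dim_col L. i < j \<longrightarrow> L $$ (i, j) = 0)"

text \<open>As usual for Cholesky factors, the diagonal is normalised to be positive, which makes the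
  factor unique.\<close>

definition reverse_cholesky :: "real mat \<Rightarrow> real mat \<Rightarrow> bool" where
  "reverse_cholesky A L \<longleftrightarrow>
     L \<in> carrier_mat (dim_row A) (dim_row A) \<and> lower_triangular L \<and>
     (\<forall>i<dim_row L. L $$ (i, i) > 0) \<and> A = L\<^sup>T * L"

section \<open>Straight-line programs over the reals\<close>

text \<open>
  A program is a list of instructions, each performing exactly one exact real operation, so its
  length is its operation count. There are no constants, no copying and no branching. A cell that
  has not been loaded or written is undefined; reading an undefined cell, dividing by zero or
  taking the square root of a negative number makes the run fail (\<open>None\<close>).
\<close>

datatype cell = In_Mat nat nat | In_Vec nat | Work nat | Out_Mat nat nat | Out_Vec nat

type_synonym memory = "cell \<Rightarrow> real option"

datatype binary_op = Plus | Minus | Times | Divide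

datatype instr =
    Binary binary_op cell cell cell  \<comment> \<open>operation, target, operands\<close>
  | Sqrt cell cell  \<comment> \<open>target, operand\<close>

type_synonym program = "instr list"

fun apply_op :: "binary_op \<Rightarrow> real \<Rightarrow> real \<Rightarrow> real option" where
  "apply_op Plus x y = Some (x + y)"
| "apply_op Minus x y = Some (x - y)"
| "apply_op Times x y = Some (x * y)"
| "apply_op Divide x y = (if y = 0 then None else Some (x / y))"

fun step :: "instr \<Rightarrow> memory \<Rightarrow> memory option" where
  "step (Binary f c a b) s =
     (case (s a, s b) of
        (Some x, Some y) \<Rightarrow> map_option (\<lambda>z. s(c \<mapsto> z)) (apply_op f x y)
      | _ \<Rightarrow> None)"
| "step (Sqrt c a) s =
     (case s a of
        Some x \<Rightarrow> if x < 0 then None else Some (s(c \<mapsto> sqrt x))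
      | None \<Rightarrow> None)"

fun run :: "program \<Rightarrow> memory \<Rightarrow> memory option" where
  "run [] s = Some s"
| "run (i # is) s = Option.bind (step i s) (run is)"

text \<open>Matrices are held sparsely: positions without a stored entry are zero. In particular a
  program with \<open>k\<close> instructions leaves at most \<open>k\<close> stored entries in its output matrix.\<close>

type_synonym sparse_mat = "nat \<times> nat \<Rightarrow> real option"

definition stored_at :: "(nat \<times> nat) set \<Rightarrow> real mat \<Rightarrow> sparse_mat" where
  "stored_at S A = (\<lambda>ij. if ij \<in> S then Some (A $$ ij) else None)"

definition stored_vec :: "real vec \<Rightarrow> nat \<Rightarrow> real option" where
  "stored_vec b = (\<lambda>i. if i < dim_vec b then Some (b $ i) else None)"

definition to_mat :: "nat \<Rightarrow> sparse_mat \<Rightarrow> real mat" where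
  "to_mat N S = mat N N (\<lambda>ij. case S ij of Some x \<Rightarrow> x | None \<Rightarrow> 0)"

definition load :: "sparse_mat \<Rightarrow> (nat \<Rightarrow> real option) \<Rightarrow> memory" where
  "load S v c = (case c of In_Mat i j \<Rightarrow> S (i, j) | In_Vec i \<Rightarrow> v i | _ \<Rightarrow> None)"

text \<open>Only cells within the \<open>N \<times> N\<close> range count as output, so that nothing but the stored matrix
  itself is passed on.\<close>

definition out_mat :: "nat \<Rightarrow> memory \<Rightarrow> sparse_mat" where
  "out_mat N s = (\<lambda>(i, j). if i < N \<and> j < N then s (Out_Mat i j) else None)"

definition out_vec :: "nat \<Rightarrow> memory \<Rightarrow> nat \<Rightarrow> real option" where
  "out_vec N s = (\<lambda>i. if i < N then s (Out_Vec i) else None)"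

text \<open>The program, loaded with only the entries of \<open>A\<close> at the positions \<open>S\<close>, ends with the sparse
  matrix \<open>F\<close> in its output cells, and \<open>F\<close> is the reverse Cholesky factor of \<open>A\<close>.\<close>

definition computes_factor ::
    "program \<Rightarrow> (nat \<times> nat) set \<Rightarrow> real mat \<Rightarrow> sparse_mat \<Rightarrow> bool" where
  "computes_factor P S A F \<longleftrightarrow>
     (\<exists>s. run P (load (stored_at S A) (\<lambda>_. None)) = Some s \<and>
        F = out_mat (dim_row A) s \<and> reverse_cholesky A (to_mat (dim_row A) F))"

text \<open>The program, loaded with only the stored factor \<open>F\<close> and the vector \<open>b\<close>, ends with the
  solution of \<open>A x = b\<close> in its output cells.\<close>

definition solves_with_factor :: "program \<Rightarrow> sparse_mat \<Rightarrow> real mat \<Rightarrow> real vec \<Rightarrow> bool" where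
  "solves_with_factor P F A b \<longleftrightarrow>
     (\<exists>s. run P (load F (stored_vec b)) = Some s \<and>
        (\<exists>x\<in>carrier_vec (dim_col A). A *\<^sub>v x = b \<and> out_vec (dim_col A) s = stored_vec x))"

end

theory Submission
  imports Defs
begin

text \<open>
  Eliminating the unknowns in the order \<open>N - 1, \<dots>, 0\<close> creates no fill-in: if the positions
  \<open>(k, i)\<close> and \<open>(k, j)\<close> with \<open>j < i < k\<close> are structurally nonzero, then so is \<open>(i, j)\<close>. Indeed, an
  unknown in block \<open>K \<ge> 1\<close> is coupled only to the unknowns with the same offset in the preceding
  \<open>l\<close> blocks and, if \<open>K \<le> l\<close>, to a window of \<open>lam + mu + 1\<close> unknowns of block \<open>0\<close>, whose pairwise
  distances are at most \<open>lam + mu\<close>. Hence the factor inherits the pattern, each row of it has at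
  most \<open>l + lam + mu + 1\<close> entries left of the diagonal, and both the factorisation and the two
  triangular solves take boundedly many operations per row.
\<close>

section \<open>Existence of the exact factor and of exact triangular solutions\<close>

section \<open>Triangular factors and triangular systems\<close>

text \<open>Matrices are functions on indices here, so that an induction on \<open>N\<close> can
  drop the last row and column without changing any matrix dimension.\<close>

definition pos_def_on :: "nat \<Rightarrow> (nat \<Rightarrow> nat \<Rightarrow> real) \<Rightarrow> bool" where
  "pos_def_on N a \<longleftrightarrow>
     (\<forall>x. (\<exists>i<N. x i \<noteq> 0) \<longrightarrow> (\<Sum>i<N. \<Sum>j<N. x i * a i j * x j) > 0)"

lemma pos_def_on_diag:
  assumes "pos_def_on N a" "k < N"
  shows "a k k > 0"
proof -
  define x :: "nat \<Rightarrow> real" where "x = (\<lambda>i. of_bool (i = k))"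
  have only: "{..<N} \<inter> {k} = {k}" using assms(2) by auto
  have "\<exists>i<N. x i \<noteq> 0" using assms(2) by (auto simp: x_def)
  then have "(\<Sum>i<N. \<Sum>j<N. x i * a i j * x j) > 0"
    using assms(1) unfolding pos_def_on_def by blast
  also have "(\<Sum>i<N. \<Sum>j<N. x i * a i j * x j) = (\<Sum>i<N. x i * a i k)"
    by (intro sum.cong refl) (simp add: x_def sum_mult_of_bool_eq only)
  also have "\<dots> = a k k"
    by (simp add: x_def sum_of_bool_mult_eq only)
  finally show ?thesis .
qed

text \<open>Completing the square in the last coordinate: minimising the quadratic form of
  \<open>a\<close> over that coordinate leaves the quadratic form of the Schur complement.\<close>

lemma pos_def_on_Schur_complement:
  assumes pd: "pos_def_on (Suc N) a"
    and sym: "\<And>i j. i < Suc N \<Longrightarrow> j < Suc N \<Longrightarrow> a i j = a j i"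
  shows "pos_def_on N (\<lambda>i j. a i j - a N i * a N j / a N N)"
  unfolding pos_def_on_def
proof (intro allI impI)
  fix x :: "nat \<Rightarrow> real"
  assume "\<exists>i<N. x i \<noteq> 0"
  then obtain i where i: "i < N" "x i \<noteq> 0" by blast
  define d where "d = a N N"
  define t where "t = (\<Sum>j<N. a N j * x j)"
  \<comment> \<open>The last coordinate minimises \<open>d * z * z + 2 * t * z\<close> over
    \<open>z\<close>; the minimum is \<open>- t * t / d\<close>.\<close>
  define y where "y = x(N := - t / d)"
  have d: "d > 0" using pos_def_on_diag[OF pd] by (simp add: d_def)
  have "y i \<noteq> 0" "i < Suc N" using i by (auto simp: y_def)
  hence "(\<Sum>i<Suc N. \<Sum>j<Suc N. y i * a i j * y j) > 0"
    using pd unfolding pos_def_on_def by blast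
  also have "(\<Sum>i<Suc N. \<Sum>j<Suc N. y i * a i j * y j)
      = (\<Sum>i<N. \<Sum>j<N. x i * a i j * x j) + (\<Sum>i<N. x i * a i N * y N)
        + (\<Sum>j<N. y N * a N j * x j) + y N * d * y N"
    by (simp add: sum.distrib sum_subtractf sum_negf y_def d_def)
  also have "(\<Sum>i<N. x i * a i N * y N) = y N * t"
    unfolding t_def sum_distrib_left by (intro sum.cong refl) (simp add: sym)
  also have "(\<Sum>j<N. y N * a N j * x j) = y N * t"
    unfolding t_def sum_distrib_left by (intro sum.cong refl) simp
  also have "(\<Sum>i<N. \<Sum>j<N. x i * a i j * x j) + y N * t + y N * t + y N * d * y N
      = (\<Sum>i<N. \<Sum>j<N. x i * a i j * x j) - t * t / d"
    using d by (simp add: y_def field_simps)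
  also have "t * t / d = (\<Sum>i<N. \<Sum>j<N. (a N i * x i) * (a N j * x j) / d)"
    unfolding t_def sum_product sum_divide_distrib ..
  also have "(\<Sum>i<N. \<Sum>j<N. x i * a i j * x j) - \<dots>
      = (\<Sum>i<N. \<Sum>j<N. x i * (a i j - a N i * a N j / a N N) * x j)"
    unfolding sum_subtractf[symmetric] d_def
    by (intro sum.cong refl) (simp add: algebra_simps)
  finally show "0 < (\<Sum>i<N. \<Sum>j<N. x i * (a i j - a N i * a N j / a N N) * x j)" .
qed

text \<open>Elimination starts from the last index: row \<open>N\<close> of the factor is row
  \<open>N\<close> of \<open>a\<close> divided by the square root of the pivot, and the Schur
  complement supplies the other rows. The zeros are claimed for all \<open>i < j\<close> because
  column \<open>N\<close> of the smaller factor, outside its own range, has to vanish too.\<close>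

lemma reverse_cholesky_exists:
  assumes "pos_def_on N a" "\<And>i j. i < N \<Longrightarrow> j < N \<Longrightarrow> a i j = a j i"
  shows "\<exists>L. (\<forall>i<N. L i i > 0) \<and> (\<forall>i j. i < j \<longrightarrow> L i j = 0) \<and>
    (\<forall>i<N. \<forall>j<N. a i j = (\<Sum>k<N. L k i * L k j))"
  using assms
proof (induction N arbitrary: a)
  case 0
  show ?case by (intro exI[of _ "\<lambda>_ _. 0"]) simp
next
  case (Suc N)
  define b where "b = (\<lambda>i j. a i j - a N i * a N j / a N N)"
  have d: "a N N > 0" using pos_def_on_diag[OF Suc.prems(1)] by simp
  have "pos_def_on N b"
    unfolding b_def using Suc.prems by (rule pos_def_on_Schur_complement)
  moreover have "b i j = b j i" if "i < N" "j < N" for i j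
    using that Suc.prems(2)[of i j] by (simp add: b_def)
  ultimately obtain L where L: "\<forall>i<N. L i i > 0" "\<forall>i j. i < j \<longrightarrow> L i j = 0"
    "\<forall>i<N. \<forall>j<N. b i j = (\<Sum>k<N. L k i * L k j)"
    using Suc.IH[of b] by metis
  define M where "M = L(N := \<lambda>j. if j \<le> N then a N j / sqrt (a N N) else 0)"
  have s: "sqrt (a N N) > 0" "sqrt (a N N) * sqrt (a N N) = a N N" using d by auto
  have lo: "(\<Sum>k<N. M k i * M k j) = (\<Sum>k<N. L k i * L k j)" for i j
    by (intro sum.cong) (auto simp: M_def)
  have hi: "M N i * M N j = a N i * a N j / a N N" if "i < Suc N" "j < Suc N" for i j
    using that s by (simp add: M_def)
  \<comment> \<open>The smaller factor contributes nothing to row and column \<open>N\<close> of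
    \<open>a\<close>, which therefore come from the new row alone.\<close>
  have z: "(\<Sum>k<N. L k i * L k j) = 0" if "i = N \<or> j = N" for i j
    using that L(2) by (intro sum.neutral) auto
  have "a i j = (\<Sum>k<Suc N. M k i * M k j)" if ij: "i < Suc N" "j < Suc N" for i j
  proof (cases "i = N \<or> j = N")
    case True
    then show ?thesis
      using z[OF True] lo[of i j] hi[OF ij] d Suc.prems(2)[of N i] ij by auto
  next
    case False
    hence "b i j = (\<Sum>k<N. L k i * L k j)" using ij L(3) by simp
    then show ?thesis using lo[of i j] hi[OF ij] by (simp add: b_def)
  qed
  moreover have "\<forall>i<Suc N. M i i > 0"
    using L(1) d s by (auto simp: M_def less_Suc_eq)
  moreover have "\<forall>i j. i < j \<longrightarrow> M i j = 0" using L(2) by (simp add: M_def)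
  ultimately show ?case by blast
qed

text \<open>Forward substitution. It supplies the values against which the second sweep of
  \<open>solve_prog\<close> is checked; the left-hand side is the content of the cell just before
  the program divides.\<close>

lemma lower_triangular_solution_exists:
  fixes L :: "nat \<Rightarrow> nat \<Rightarrow> real"
  assumes "\<And>i. i < N \<Longrightarrow> L i i \<noteq> 0"
  shows "\<exists>x. \<forall>i<N. L i i * x i = y i - (\<Sum>j<i. L i j * x j)"
  using assms
proof (induction N)
  case 0
  show ?case by simp
next
  case (Suc N)
  then obtain x where x: "\<forall>i<N. L i i * x i = y i - (\<Sum>j<i. L i j * x j)" by auto
  define x' where "x' = x(N := (y N - (\<Sum>j<N. L N j * x j)) / L N N)"
  have "(\<Sum>j<i. L i j * x' j) = (\<Sum>j<i. L i j * x j)" if "i \<le> N" for i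
    using that by (intro sum.cong) (auto simp: x'_def)
  then have "\<forall>i<Suc N. L i i * x' i = y i - (\<Sum>j<i. L i j * x' j)"
    using x Suc.prems[of N] by (auto simp: less_Suc_eq) (simp_all add: x'_def)
  then show ?case by blast
qed

text \<open>Back substitution with the transpose of \<open>L\<close>. The last unknown is found
  first and moved to the right-hand side, hence the generalisation over \<open>b\<close> in the
  induction.\<close>

lemma upper_triangular_solution_exists:
  fixes L :: "nat \<Rightarrow> nat \<Rightarrow> real"
  assumes "\<And>i. i < N \<Longrightarrow> L i i \<noteq> 0"
  shows "\<exists>y. \<forall>j<N. L j j * y j = b j - (\<Sum>k\<in>{j<..<N}. L k j * y k)"
  using assms
proof (induction N arbitrary: b)
  case 0
  show ?case by simp
next
  case (Suc N)
  define t where "t = b N / L N N"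
  obtain y where
    y: "\<forall>j<N. L j j * y j = (b j - L N j * t) - (\<Sum>k\<in>{j<..<N}. L k j * y k)"
    using Suc.IH[of "\<lambda>j. b j - L N j * t"] Suc.prems by auto
  have "L j j * (y(N := t)) j = b j - (\<Sum>k\<in>{j<..<Suc N}. L k j * (y(N := t)) k)"
    if "j < Suc N" for j
  proof (cases "j = N")
    case True
    have "{N<..<Suc N} = {}" by auto
    then show ?thesis using True Suc.prems[of N] by (simp add: t_def)
  next
    case False
    have "{j<..<Suc N} = insert N {j<..<N}" using that False by auto
    moreover have "(\<Sum>k\<in>{j<..<N}. L k j * (y(N := t)) k) = (\<Sum>k\<in>{j<..<N}. L k j * y k)"
      by (intro sum.cong) auto
    ultimately show ?thesis using that False y by simp
  qed
  then show ?case by blast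
qed

section \<open>Loop rules, the two programs and their operation counts\<close>

section \<open>Straight-line programs\<close>

lemma run_append: "run (P @ Q) s = Option.bind (run P s) (run Q)"
proof (induction P arbitrary: s)
  case (Cons i P)
  then show ?case by (cases "step i s") simp_all
qed simp

text \<open>Loop rule: the invariant depends only on the set of elements already treated, while the
  split \<open>xs = ys @ x # zs\<close> tells the body where in the traversal it stands.\<close>

lemma run_foreach:
  assumes "distinct xs"
    and "\<And>ys x zs s. xs = ys @ x # zs \<Longrightarrow> x \<notin> set ys \<Longrightarrow> Inv (set ys) s \<Longrightarrow>
      \<exists>s'. run (f x) s = Some s' \<and> Inv (insert x (set ys)) s'"
    and "Inv {} s"
  shows "\<exists>s'. run (concat (map f xs)) s = Some s' \<and> Inv (set xs) s'"
  using assms(1,2)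
proof (induction xs rule: rev_induct)
  case Nil
  then show ?case using assms(3) by simp
next
  case (snoc x xs)
  have "\<exists>s'. run (concat (map f xs)) s = Some s' \<and> Inv (set xs) s'"
  proof (rule snoc.IH)
    fix ys y zs t
    assume "xs = ys @ y # zs" "y \<notin> set ys" "Inv (set ys) t"
    then show "\<exists>s'. run (f y) t = Some s' \<and> Inv (insert y (set ys)) s'"
      by (intro snoc.prems(2)[of ys y "zs @ [x]"]) auto
  qed (use snoc.prems in simp)
  then obtain t where t: "run (concat (map f xs)) s = Some t" "Inv (set xs) t" by blast
  then obtain s' where "run (f x) t = Some s'" "Inv (insert x (set xs)) s'"
    using snoc.prems(2)[of xs x "[]" t] snoc.prems(1) by auto
  then show ?case using t by (auto simp: run_append)
qed

text \<open>Turns the set of treated elements in \<open>run_foreach\<close> into an interval, for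
  ascending loops here and for descending ones in \<open>set_prefix_rev_upt\<close>.\<close>

lemma set_prefix_upt:
  assumes "[0..<N] = ys @ x # zs"
  shows "x < N \<and> set ys = {..<x}"
proof -
  have len: "length ys < N" using arg_cong[OF assms, of length] by simp
  have "x = [0..<N] ! length ys" "ys = take (length ys) [0..<N]" using assms by simp_all
  then have "x = length ys" "ys = [0..<length ys]" using len by (simp_all add: take_upt)
  then show ?thesis using len by (metis lessThan_atLeast0 set_upt)
qed

lemma set_prefix_rev_upt:
  assumes "rev [0..<N] = ys @ x # zs"
  shows "x < N \<and> set ys = {x<..<N}"
proof -
  have "[0..<N] = rev zs @ x # rev ys" using arg_cong[OF assms, of rev] by simp
  moreover from this have "x < N \<and> set (rev zs) = {..<x}" by (rule set_prefix_upt)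
  moreover have "distinct [0..<N]" "set [0..<N] = {..<N}" by (simp_all add: lessThan_atLeast0)
  ultimately have "x < N" "set zs = {..<x}" "{..<N} = set zs \<union> {x} \<union> set ys"
    "x \<notin> set ys" "set zs \<inter> set ys = {}" by auto
  then have "set ys = {..<N} - insert x {..<x}" by blast
  also have "\<dots> = {x<..<N}" by auto
  finally show ?thesis using \<open>x < N\<close> by blast
qed

text \<open>\<open>nbs k\<close> lists the possibly nonzero columns left of the diagonal in row
  \<open>k\<close>. The last assumption is the absence of fill-in: the earlier neighbours of
  \<open>k\<close> form a clique, so \<open>N - 1, \<dots>, 0\<close> is a perfect elimination
  ordering.\<close>

locale elimination_pattern =
  fixes N :: nat and nbs :: "nat \<Rightarrow> nat list"
  assumes distinct_nbs: "distinct (nbs k)"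
    and nbs_less: "j \<in> set (nbs k) \<Longrightarrow> j < k"
    and nbs_closed: "k < N \<Longrightarrow> i \<in> set (nbs k) \<Longrightarrow> j \<in> set (nbs k) \<Longrightarrow> j < i \<Longrightarrow> j \<in> set (nbs i)"
begin

definition pattern :: "(nat \<times> nat) set" where
  "pattern = {(i, j). i < N \<and> (j = i \<or> j \<in> set (nbs i))}"

text \<open>By symmetry the update is confined to the lower triangle; \<open>pattern\<close> holds
  no other positions.\<close>

definition nbs_pairs :: "nat \<Rightarrow> (nat \<times> nat) list" where
  "nbs_pairs k = filter (\<lambda>(i, j). j \<le> i) (List.product (nbs k) (nbs k))"

text \<open>One step of right-looking elimination: square root of the pivot, scaling of its row,
  then the rank-one update to the Schur complement, done in place on the input cells.\<close>

definition pivot_prog :: "nat \<Rightarrow> program" where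
  "pivot_prog k = [Sqrt (Out_Mat k k) (In_Mat k k)] @
     concat (map (\<lambda>j. [Binary Divide (Out_Mat k j) (In_Mat k j) (Out_Mat k k)]) (nbs k)) @
     concat (map (\<lambda>(i, j). [Binary Times (Work 0) (Out_Mat k i) (Out_Mat k j),
        Binary Minus (In_Mat i j) (In_Mat i j) (Work 0)]) (nbs_pairs k))"

definition factor_prog :: program where
  "factor_prog = concat (map pivot_prog (rev [0..<N]))"

text \<open>\<open>nbs\<close> gives access to \<open>L\<close> by rows, hence to its transpose by
  columns: each new unknown is spread at once over the remaining right-hand sides.\<close>

definition back_step :: "nat \<Rightarrow> program" where
  "back_step k = Binary Divide (In_Vec k) (In_Vec k) (In_Mat k k) #
     concat (map (\<lambda>j. [Binary Times (Work 0) (In_Mat k j) (In_Vec k),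
        Binary Minus (In_Vec j) (In_Vec j) (Work 0)]) (nbs k))"

text \<open>Here row \<open>k\<close> gathers the known unknowns before the division. Its right-hand
  side is what the backward sweep left in the input vector.\<close>

definition forward_step :: "nat \<Rightarrow> program" where
  "forward_step k =
     concat (map (\<lambda>j. [Binary Times (Work 0) (In_Mat k j) (Out_Vec j),
        Binary Minus (In_Vec k) (In_Vec k) (Work 0)]) (nbs k)) @
     [Binary Divide (Out_Vec k) (In_Vec k) (In_Mat k k)]"

definition solve_prog :: program where
  "solve_prog = concat (map back_step (rev [0..<N])) @ concat (map forward_step [0..<N])"

lemma length_concat_map_le:
  assumes "\<And>x. x \<in> set xs \<Longrightarrow> length (f x) \<le> c"
  shows "length (concat (map f xs)) \<le> c * length xs"
  using assms
proof (induction xs)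
  case (Cons x xs)
  then have "length (f x) \<le> c" "length (concat (map f xs)) \<le> c * length xs" by simp_all
  then show ?case by simp
qed simp

text \<open>Each pivot costs one square root, at most \<open>c\<close> divisions, and two operations
  for each of at most \<open>c * c\<close> pairs.\<close>

lemma length_factor_prog:
  assumes "\<And>k. k < N \<Longrightarrow> length (nbs k) \<le> c"
  shows "length factor_prog \<le> (1 + c + 2 * c * c) * N"
proof -
  have "length (pivot_prog k) \<le> 1 + c + 2 * c * c" if "k < N" for k
  proof -
    have *: "length (nbs k) \<le> c" using assms that .
    have "length (nbs_pairs k) \<le> length (nbs k) * length (nbs k)"
      unfolding nbs_pairs_def by (metis length_filter_le length_product)
    also have "\<dots> \<le> c * c" using * by (intro mult_mono) auto
    finally have "2 * length (nbs_pairs k) \<le> 2 * c * c" by simp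
    moreover have "length (concat (map (\<lambda>(i, j). [Binary Times (Work 0) (Out_Mat k i) (Out_Mat k j),
        Binary Minus (In_Mat i j) (In_Mat i j) (Work 0)]) (nbs_pairs k))) \<le> 2 * length (nbs_pairs k)"
      by (rule length_concat_map_le) auto
    moreover have "length (concat (map (\<lambda>j. [Binary Divide (Out_Mat k j) (In_Mat k j) (Out_Mat k k)])
        (nbs k))) \<le> 1 * length (nbs k)"
      by (rule length_concat_map_le) auto
    ultimately show ?thesis unfolding pivot_prog_def length_append using * by simp
  qed
  then have "length factor_prog \<le> (1 + c + 2 * c * c) * length (rev [0..<N])"
    unfolding factor_prog_def by (intro length_concat_map_le) auto
  then show ?thesis by simp
qed

text \<open>Each of the two sweeps spends one division per row, and one multiplication and one
  subtraction per neighbour.\<close>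

lemma length_solve_prog:
  assumes "\<And>k. k < N \<Longrightarrow> length (nbs k) \<le> c"
  shows "length solve_prog \<le> (2 + 4 * c) * N"
proof -
  have "length (concat (map (\<lambda>j. [Binary Times (Work 0) (In_Mat k j) (In_Vec k),
        Binary Minus (In_Vec j) (In_Vec j) (Work 0)]) (nbs k))) \<le> 2 * length (nbs k)"
    "length (concat (map (\<lambda>j. [Binary Times (Work 0) (In_Mat k j) (Out_Vec j),
        Binary Minus (In_Vec k) (In_Vec k) (Work 0)]) (nbs k))) \<le> 2 * length (nbs k)" for k
    by (rule length_concat_map_le; auto)+
  moreover have "2 * length (nbs k) \<le> 2 * c" if "k < N" for k
    using assms that by simp
  ultimately have *: "length (back_step k) \<le> 1 + 2 * c" "length (forward_step k) \<le> 1 + 2 * c"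
    if "k < N" for k
    using that unfolding back_step_def forward_step_def length_append length_Cons
    by (fastforce intro: le_trans)+
  have "length (concat (map back_step (rev [0..<N]))) \<le> (1 + 2 * c) * length (rev [0..<N])"
    "length (concat (map forward_step [0..<N])) \<le> (1 + 2 * c) * length [0..<N]"
    by (rule length_concat_map_le; use * in simp)+
  then show ?thesis unfolding solve_prog_def length_append by (simp add: algebra_simps)
qed

end

section \<open>Verification of the programs against a known factor\<close>

section \<open>Correctness of elimination and substitution\<close>

text \<open>The factor is given in advance, so verifying a program amounts to comparing each cell
  with a value already known.\<close>

locale pattern_factor = elimination_pattern +
  fixes L :: "nat \<Rightarrow> nat \<Rightarrow> real"
  assumes diag_pos: "i < N \<Longrightarrow> L i i > 0"
    and zero_outside: "i < N \<Longrightarrow> (i, j) \<notin> pattern \<Longrightarrow> L i j = 0"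
begin

lemma lower: "i < N \<Longrightarrow> i < j \<Longrightarrow> L i j = 0"
  using zero_outside[of i j] nbs_less[of j i] by (auto simp: pattern_def)

text \<open>Once the rows in \<open>D\<close> are eliminated, the input cells of the other rows hold
  the Schur complement, expressed through \<open>L\<close>. Output cells are fixed even where
  undefined, since the stored factor has to match exactly.\<close>

definition factor_inv :: "(nat \<Rightarrow> nat \<Rightarrow> real) \<Rightarrow> nat set \<Rightarrow> memory \<Rightarrow> bool" where
  "factor_inv a D s \<longleftrightarrow>
     (\<forall>i j. (i, j) \<in> pattern \<and> i \<notin> D \<longrightarrow>
        s (In_Mat i j) = Some (a i j - (\<Sum>r\<in>D. L r i * L r j))) \<and>
     (\<forall>i j. s (Out_Mat i j) = (if i \<in> D \<and> (i, j) \<in> pattern then Some (L i j) else None))"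

text \<open>The pivot row of the Schur complement is \<open>L k k * L k j\<close>, so the square
  root and the divisions reproduce row \<open>k\<close> of \<open>L\<close>; the update then adds
  the term \<open>r = k\<close> to the sums in \<open>factor_inv\<close>.\<close>

lemma run_pivot:
  assumes k: "k < N"
    and a: "\<And>i j. i < N \<Longrightarrow> j < N \<Longrightarrow> a i j = (\<Sum>r<N. L r i * L r j)"
    and inv: "factor_inv a {k<..<N} s"
  shows "\<exists>s'. run (pivot_prog k) s = Some s' \<and> factor_inv a {k..<N} s'"
proof -
  \<comment> \<open>The terms with \<open>r > k\<close> are already subtracted and those with
    \<open>r < k\<close> vanish by triangularity, which leaves the term of row
    \<open>k\<close>.\<close>
  have remainder: "a k j - (\<Sum>r\<in>{k<..<N}. L r k * L r j) = L k k * L k j" if "j \<le> k" for j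
  proof -
    have "{..<N} = insert k ({..<k} \<union> {k<..<N})" using k by auto
    then have "a k j = L k k * L k j + ((\<Sum>r<k. L r k * L r j) + (\<Sum>r\<in>{k<..<N}. L r k * L r j))"
      using a[of k j] that k sum.union_disjoint[of "{..<k}" "{k<..<N}" "\<lambda>r. L r k * L r j"]
      by (simp add: disjoint_iff)
    moreover have "(\<Sum>r<k. L r k * L r j) = 0"
      using k by (intro sum.neutral) (auto simp: lower)
    ultimately show ?thesis by simp
  qed
  have kk: "(k, k) \<in> pattern" using k by (simp add: pattern_def)
  define s1 where "s1 = s(Out_Mat k k \<mapsto> L k k)"
  have in1: "s (In_Mat k k) = Some (L k k * L k k)"
    using inv kk remainder[of k] unfolding factor_inv_def by force
  have run1: "run [Sqrt (Out_Mat k k) (In_Mat k k)] s = Some s1"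
    using diag_pos[OF k] by (simp add: in1 s1_def)
  define Inv2 where "Inv2 = (\<lambda>D t. t (Out_Mat k k) = Some (L k k) \<and>
     (\<forall>i j. t (In_Mat i j) = s (In_Mat i j)) \<and>
     (\<forall>i j. t (Out_Mat i j) = (if i = k \<and> (j = k \<or> j \<in> D) then Some (L i j) else s (Out_Mat i j))))"
  have "\<exists>s2. run (concat (map (\<lambda>j. [Binary Divide (Out_Mat k j) (In_Mat k j) (Out_Mat k k)]) (nbs k)))
      s1 = Some s2 \<and> Inv2 (set (nbs k)) s2"
  proof (rule run_foreach[OF distinct_nbs])
    show "Inv2 {} s1" by (auto simp: Inv2_def s1_def)
    fix ys j zs t
    assume j: "nbs k = ys @ j # zs" and t: "Inv2 (set ys) t"
    then have "j \<in> set (nbs k)" by simp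
    then have "j < k" "(k, j) \<in> pattern" using nbs_less k by (auto simp: pattern_def)
    then have "s (In_Mat k j) = Some (L k k * L k j)"
      using inv remainder[of j] unfolding factor_inv_def by force
    then have "run [Binary Divide (Out_Mat k j) (In_Mat k j) (Out_Mat k k)] t
        = Some (t(Out_Mat k j \<mapsto> L k j))"
      using t diag_pos[OF k] by (simp add: Inv2_def)
    moreover have "Inv2 (insert j (set ys)) (t(Out_Mat k j \<mapsto> L k j))"
      using t by (auto simp: Inv2_def)
    ultimately show "\<exists>s'. run [Binary Divide (Out_Mat k j) (In_Mat k j) (Out_Mat k k)] t = Some s' \<and>
      Inv2 (insert j (set ys)) s'" by blast
  qed
  then obtain s2 where run2: "run (concat (map (\<lambda>j. [Binary Divide (Out_Mat k j) (In_Mat k j)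
      (Out_Mat k k)]) (nbs k))) s1 = Some s2" and s2: "Inv2 (set (nbs k)) s2" by blast
  have row: "s2 (Out_Mat k j) = Some (L k j)" if "j \<in> set (nbs k)" for j
    using s2 that by (simp add: Inv2_def)
  \<comment> \<open>Input cells are described relative to the state \<open>s\<close> before the
    pivot; as the pairs are distinct, each position is reduced exactly once.\<close>
  define Inv3 where "Inv3 = (\<lambda>D t. (\<forall>i j. t (Out_Mat i j) = s2 (Out_Mat i j)) \<and>
     (\<forall>i j. t (In_Mat i j) = (if (i, j) \<in> D
        then map_option (\<lambda>z. z - L k i * L k j) (s (In_Mat i j)) else s (In_Mat i j))))"
  let ?f = "\<lambda>(i, j). [Binary Times (Work 0) (Out_Mat k i) (Out_Mat k j),
        Binary Minus (In_Mat i j) (In_Mat i j) (Work 0)]"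
  have "\<exists>s3. run (concat (map ?f (nbs_pairs k))) s2 = Some s3 \<and> Inv3 (set (nbs_pairs k)) s3"
  proof (rule run_foreach)
    show "distinct (nbs_pairs k)"
      by (simp add: nbs_pairs_def distinct_nbs distinct_product)
    show "Inv3 {} s2" using s2 by (simp add: Inv3_def Inv2_def)
    fix ys ij zs t
    assume pre: "nbs_pairs k = ys @ ij # zs" and new: "ij \<notin> set ys" and t: "Inv3 (set ys) t"
    obtain i j where ij: "ij = (i, j)" by fastforce
    have "ij \<in> set (nbs_pairs k)" using pre by simp
    then have mem: "i \<in> set (nbs k)" "j \<in> set (nbs k)" "j \<le> i"
      by (auto simp: nbs_pairs_def ij)
    have "i < k" using mem nbs_less by simp
    \<comment> \<open>No fill-in: the position to be updated lies in the pattern, by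
      \<open>nbs_closed\<close> or on the diagonal, so its input cell is defined.\<close>
    moreover have "(i, j) \<in> pattern"
      using mem nbs_closed[OF k mem(1,2)] \<open>i < k\<close> k by (cases "j < i") (auto simp: pattern_def)
    ultimately obtain z where z: "s (In_Mat i j) = Some z"
      using inv unfolding factor_inv_def by auto
    let ?t = "t(Work 0 \<mapsto> L k i * L k j, In_Mat i j \<mapsto> z - L k i * L k j)"
    have "run (?f ij) t = Some ?t"
      using t z new row mem by (simp add: ij Inv3_def)
    moreover have "Inv3 (insert ij (set ys)) ?t"
      using t z new by (auto simp: Inv3_def ij)
    ultimately show "\<exists>s'. run (?f ij) t = Some s' \<and> Inv3 (insert ij (set ys)) s'" by blast
  qed
  then obtain s3 where run3: "run (concat (map ?f (nbs_pairs k))) s2 = Some s3"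
    and s3: "Inv3 (set (nbs_pairs k)) s3" by blast
  have split: "{k..<N} = insert k {k<..<N}" using k by auto
  have "factor_inv a {k..<N} s3"
    unfolding factor_inv_def
  proof (intro conjI allI impI)
    fix i j
    assume asm: "(i, j) \<in> pattern \<and> i \<notin> {k..<N}"
    then have i: "i < k" "j \<le> i" using nbs_less[of j i] by (auto simp: pattern_def)
    then have old: "s (In_Mat i j) = Some (a i j - (\<Sum>r\<in>{k<..<N}. L r i * L r j))"
      using inv asm unfolding factor_inv_def by simp
    \<comment> \<open>Positions skipped by the loop need no update, since one of the two factors
      vanishes.\<close>
    have zero: "L k i * L k j = 0" if "(i, j) \<notin> set (nbs_pairs k)"
    proof -
      have "i \<notin> set (nbs k) \<or> j \<notin> set (nbs k)"
        using that i by (auto simp: nbs_pairs_def)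
      then have "(k, i) \<notin> pattern \<or> (k, j) \<notin> pattern" using i by (auto simp: pattern_def)
      then show ?thesis using zero_outside[OF k] by auto
    qed
    show "s3 (In_Mat i j) = Some (a i j - (\<Sum>r\<in>{k..<N}. L r i * L r j))"
      using s3 old zero by (auto simp: Inv3_def split)
  next
    fix i j
    show "s3 (Out_Mat i j) = (if i \<in> {k..<N} \<and> (i, j) \<in> pattern then Some (L i j) else None)"
      using s3 s2 inv k by (auto simp: Inv3_def Inv2_def factor_inv_def split pattern_def)
  qed
  moreover have "run (pivot_prog k) s = Some s3"
    unfolding pivot_prog_def by (simp only: run_append run1 run2 run3 Option.bind.simps)
  ultimately show ?thesis by blast
qed

lemma run_factor_prog:
  assumes a: "\<And>i j. i < N \<Longrightarrow> j < N \<Longrightarrow> a i j = (\<Sum>r<N. L r i * L r j)"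
    and "\<And>i j. (i, j) \<in> pattern \<Longrightarrow> s (In_Mat i j) = Some (a i j)"
    and "\<And>i j. s (Out_Mat i j) = None"
  shows "\<exists>s'. run factor_prog s = Some s' \<and>
    (\<forall>i j. s' (Out_Mat i j) = (if (i, j) \<in> pattern then Some (L i j) else None))"
proof -
  have "\<exists>s'. run factor_prog s = Some s' \<and> factor_inv a (set (rev [0..<N])) s'"
    unfolding factor_prog_def
  proof (rule run_foreach)
    show "factor_inv a {} s" using assms by (auto simp: factor_inv_def)
    fix ys k zs t
    assume "rev [0..<N] = ys @ k # zs" and t: "factor_inv a (set ys) t"
    then have k: "k < N" "set ys = {k<..<N}" using set_prefix_rev_upt by blast+
    have "insert k {k<..<N} = {k..<N}" using k by auto
    then show "\<exists>s'. run (pivot_prog k) t = Some s' \<and> factor_inv a (insert k (set ys)) s'"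
      using run_pivot[OF k(1) a, of t] t k by simp
  qed simp
  then show ?thesis by (auto simp: factor_inv_def pattern_def)
qed

text \<open>The input vector is overwritten in place: finished cells hold \<open>y\<close>, the
  others the right-hand side reduced by the finished unknowns. The undefined output vector is
  carried along for the forward sweep.\<close>

definition back_inv :: "(nat \<Rightarrow> real) \<Rightarrow> (nat \<Rightarrow> real) \<Rightarrow> nat set \<Rightarrow> memory \<Rightarrow> bool" where
  "back_inv b y D s \<longleftrightarrow>
     (\<forall>i j. (i, j) \<in> pattern \<longrightarrow> s (In_Mat i j) = Some (L i j)) \<and>
     (\<forall>j<N. s (In_Vec j) = Some (if j \<in> D then y j else b j - (\<Sum>r\<in>D. L r j * y r))) \<and>
     (\<forall>j. s (Out_Vec j) = None)"

lemma run_back_step: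
  assumes k: "k < N"
    and y: "L k k * y k = b k - (\<Sum>r\<in>{k<..<N}. L r k * y r)"
    and inv: "back_inv b y {k<..<N} s"
  shows "\<exists>s'. run (back_step k) s = Some s' \<and> back_inv b y {k..<N} s'"
proof -
  have kk: "(k, k) \<in> pattern" using k by (simp add: pattern_def)
  define s1 where "s1 = s(In_Vec k \<mapsto> y k)"
  have "s (In_Vec k) = Some (L k k * y k)" "s (In_Mat k k) = Some (L k k)"
    using inv k y kk by (auto simp: back_inv_def)
  then have run1: "step (Binary Divide (In_Vec k) (In_Vec k) (In_Mat k k)) s = Some s1"
    using diag_pos[OF k] by (simp add: s1_def)
  define Inv where "Inv = (\<lambda>D t. (\<forall>i j. (i, j) \<in> pattern \<longrightarrow> t (In_Mat i j) = Some (L i j)) \<and>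
     (\<forall>j<N. t (In_Vec j) = (if j \<in> D
        then map_option (\<lambda>z. z - L k j * y k) (s1 (In_Vec j)) else s1 (In_Vec j))) \<and>
     (\<forall>j. t (Out_Vec j) = None))"
  let ?f = "\<lambda>j. [Binary Times (Work 0) (In_Mat k j) (In_Vec k),
        Binary Minus (In_Vec j) (In_Vec j) (Work 0)]"
  have "\<exists>s2. run (concat (map ?f (nbs k))) s1 = Some s2 \<and> Inv (set (nbs k)) s2"
  proof (rule run_foreach[OF distinct_nbs])
    show "Inv {} s1" using inv by (simp add: Inv_def s1_def back_inv_def)
    fix ys j zs t
    assume pre: "nbs k = ys @ j # zs" and new: "j \<notin> set ys" and t: "Inv (set ys) t"
    \<comment> \<open>Neighbours of \<open>k\<close> are smaller than \<open>k\<close>, so the loop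
      never overwrites the cell holding \<open>y k\<close>.\<close>
    have "j \<in> set (nbs k)" "k \<notin> set ys" using pre nbs_less[of k k] by auto
    then have j: "j < k" "(k, j) \<in> pattern" "t (In_Vec k) = Some (y k)"
      using nbs_less k t by (auto simp: pattern_def Inv_def s1_def)
    then obtain z where z: "s1 (In_Vec j) = Some z"
      using inv k by (auto simp: back_inv_def s1_def)
    let ?t = "t(Work 0 \<mapsto> L k j * y k, In_Vec j \<mapsto> z - L k j * y k)"
    have "run (?f j) t = Some ?t" using t j z new k by (simp add: Inv_def)
    moreover have "Inv (insert j (set ys)) ?t" using t z new by (auto simp: Inv_def)
    ultimately show "\<exists>s'. run (?f j) t = Some s' \<and> Inv (insert j (set ys)) s'" by blast
  qed
  then obtain s2 where run2: "run (concat (map ?f (nbs k))) s1 = Some s2"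
    and s2: "Inv (set (nbs k)) s2" by blast
  have split: "{k..<N} = insert k {k<..<N}" using k by auto
  have "s2 (In_Vec j) = Some (if j \<in> {k..<N} then y j else b j - (\<Sum>r\<in>{k..<N}. L r j * y r))"
    if "j < N" for j
  proof (cases "j \<ge> k")
    case True
    then have "j \<notin> set (nbs k)" using nbs_less[of j k] by auto
    then show ?thesis using True s2 that inv by (auto simp: Inv_def s1_def back_inv_def)
  next
    case False
    \<comment> \<open>A cell left alone by the loop corresponds to a zero in row \<open>k\<close>,
      so the new term of its sum is zero.\<close>
    have "L k j = 0" if "j \<notin> set (nbs k)"
      using zero_outside[OF k, of j] that False by (auto simp: pattern_def)
    then show ?thesis using False s2 that inv
      by (auto simp: Inv_def s1_def back_inv_def split)
  qed
  then have "back_inv b y {k..<N} s2" using s2 by (simp add: back_inv_def Inv_def)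
  then show ?thesis using run1 run2 by (simp add: back_step_def)
qed

text \<open>Nothing is claimed about the input cells in \<open>D\<close>, which may have been
  overwritten by partial residuals.\<close>

definition forward_inv :: "(nat \<Rightarrow> real) \<Rightarrow> (nat \<Rightarrow> real) \<Rightarrow> nat set \<Rightarrow> memory \<Rightarrow> bool" where
  "forward_inv y x D s \<longleftrightarrow>
     (\<forall>i j. (i, j) \<in> pattern \<longrightarrow> s (In_Mat i j) = Some (L i j)) \<and>
     (\<forall>j<N. j \<notin> D \<longrightarrow> s (In_Vec j) = Some (y j)) \<and>
     (\<forall>j. s (Out_Vec j) = (if j \<in> D then Some (x j) else None))"

lemma run_forward_step:
  assumes k: "k < N"
    and x: "L k k * x k = y k - (\<Sum>j<k. L k j * x j)"
    and inv: "forward_inv y x {..<k} s"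
  shows "\<exists>s'. run (forward_step k) s = Some s' \<and> forward_inv y x {..<Suc k} s'"
proof -
  define Inv where "Inv = (\<lambda>D t. (\<forall>i j. (i, j) \<in> pattern \<longrightarrow> t (In_Mat i j) = Some (L i j)) \<and>
     t (In_Vec k) = Some (y k - (\<Sum>j\<in>D. L k j * x j)) \<and>
     (\<forall>j<N. k < j \<longrightarrow> t (In_Vec j) = Some (y j)) \<and>
     (\<forall>j. t (Out_Vec j) = (if j < k then Some (x j) else None)))"
  let ?f = "\<lambda>j. [Binary Times (Work 0) (In_Mat k j) (Out_Vec j),
        Binary Minus (In_Vec k) (In_Vec k) (Work 0)]"
  have "\<exists>s1. run (concat (map ?f (nbs k))) s = Some s1 \<and> Inv (set (nbs k)) s1"
  proof (rule run_foreach[OF distinct_nbs])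
    show "Inv {} s" using inv k by (auto simp: Inv_def forward_inv_def)
    fix ys j zs t
    assume pre: "nbs k = ys @ j # zs" and new: "j \<notin> set ys" and t: "Inv (set ys) t"
    have "j \<in> set (nbs k)" using pre by simp
    then have j: "j < k" "(k, j) \<in> pattern" using nbs_less k by (auto simp: pattern_def)
    let ?t = "t(Work 0 \<mapsto> L k j * x j,
      In_Vec k \<mapsto> y k - (\<Sum>i\<in>set ys. L k i * x i) - L k j * x j)"
    have "run (?f j) t = Some ?t" using t j by (simp add: Inv_def)
    moreover have "Inv (insert j (set ys)) ?t" using t new by (auto simp: Inv_def)
    ultimately show "\<exists>s'. run (?f j) t = Some s' \<and> Inv (insert j (set ys)) s'" by blast
  qed
  then obtain s1 where run1: "run (concat (map ?f (nbs k))) s = Some s1"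
    and s1: "Inv (set (nbs k)) s1" by blast
  \<comment> \<open>Row \<open>k\<close> vanishes away from its neighbours, so the short sum
    subtracted by the loop is the full one.\<close>
  have "(\<Sum>j<k. L k j * x j) = (\<Sum>j\<in>set (nbs k). L k j * x j)"
    using nbs_less zero_outside[OF k]
    by (intro sum.mono_neutral_right) (auto simp: pattern_def)
  then have "s1 (In_Vec k) = Some (L k k * x k)" "s1 (In_Mat k k) = Some (L k k)"
    using s1 x k by (auto simp: Inv_def pattern_def)
  then have "run [Binary Divide (Out_Vec k) (In_Vec k) (In_Mat k k)] s1
      = Some (s1(Out_Vec k \<mapsto> x k))"
    using diag_pos[OF k] by simp
  moreover have "forward_inv y x {..<Suc k} (s1(Out_Vec k \<mapsto> x k))"
    using s1 by (auto simp: forward_inv_def Inv_def)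
  ultimately show ?thesis using run1
    by (auto simp: forward_step_def run_append simp del: run.simps)
qed

lemma run_solve_prog:
  assumes y: "\<And>k. k < N \<Longrightarrow> L k k * y k = b k - (\<Sum>r\<in>{k<..<N}. L r k * y r)"
    and x: "\<And>k. k < N \<Longrightarrow> L k k * x k = y k - (\<Sum>j<k. L k j * x j)"
    and "\<And>i j. (i, j) \<in> pattern \<Longrightarrow> s (In_Mat i j) = Some (L i j)"
    and "\<And>j. j < N \<Longrightarrow> s (In_Vec j) = Some (b j)"
    and "\<And>j. s (Out_Vec j) = None"
  shows "\<exists>s'. run solve_prog s = Some s' \<and>
    (\<forall>j. s' (Out_Vec j) = (if j < N then Some (x j) else None))"
proof -
  have "\<exists>s'. run (concat (map back_step (rev [0..<N]))) s = Some s' \<and>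
      back_inv b y (set (rev [0..<N])) s'"
  proof (rule run_foreach)
    show "back_inv b y {} s" using assms by (auto simp: back_inv_def)
    fix ys k zs t
    assume "rev [0..<N] = ys @ k # zs" and t: "back_inv b y (set ys) t"
    then have k: "k < N" "set ys = {k<..<N}" using set_prefix_rev_upt by blast+
    have "insert k {k<..<N} = {k..<N}" using k by auto
    then show "\<exists>s'. run (back_step k) t = Some s' \<and> back_inv b y (insert k (set ys)) s'"
      using run_back_step[where y = y and b = b, OF k(1) y[OF k(1)], of t] t k by simp
  qed simp
  then obtain s1 where s1: "run (concat (map back_step (rev [0..<N]))) s = Some s1"
    "back_inv b y (set (rev [0..<N])) s1" by blast
  have "\<exists>s'. run (concat (map forward_step [0..<N])) s1 = Some s' \<and>
      forward_inv y x (set [0..<N]) s'"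
  proof (rule run_foreach)
    \<comment> \<open>With all indices treated, \<open>back_inv\<close> says that the input vector
      holds \<open>y\<close> and that \<open>L\<close> is still in place: the start of the forward
      sweep.\<close>
    show "forward_inv y x {} s1" using s1(2) by (auto simp: back_inv_def forward_inv_def)
    fix ys k zs t
    assume "[0..<N] = ys @ k # zs" and t: "forward_inv y x (set ys) t"
    then have k: "k < N" "set ys = {..<k}" using set_prefix_upt by blast+
    then show "\<exists>s'. run (forward_step k) t = Some s' \<and> forward_inv y x (insert k (set ys)) s'"
      using run_forward_step[where y = y and x = x, OF k(1) x[OF k(1)], of t] t by (simp add: lessThan_Suc)
  qed simp
  then show ?thesis using s1(1) by (auto simp: solve_prog_def run_append forward_inv_def)
qed

end

section \<open>Block coordinates and the sparsity pattern of the matrix\<close>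

section \<open>The pattern of a B3-arrowhead matrix\<close>

text \<open>Together with \<open>block_offset\<close> this inverts
  \<open>block_start m n K + r\<close>. Division by \<open>n = 0\<close> is harmless: the matrix
  then has size \<open>m\<close>, and only the first branch concerns it.\<close>

definition block_index :: "nat \<Rightarrow> nat \<Rightarrow> nat \<Rightarrow> nat" where
  "block_index m n i = (if i < m then 0 else Suc ((i - m) div n))"

definition block_offset :: "nat \<Rightarrow> nat \<Rightarrow> nat \<Rightarrow> nat" where
  "block_offset m n i = (if i < m then i else (i - m) mod n)"

text \<open>The five structural conditions as one predicate on block indices \<open>K\<close>,
  \<open>J\<close> and offsets \<open>i\<close>, \<open>j\<close>, with integer differences
  rewritten as sums of naturals.\<close>

definition admissible ::
    "nat \<Rightarrow> nat \<Rightarrow> nat \<Rightarrow> nat \<Rightarrow> nat \<Rightarrow> nat \<Rightarrow> nat \<Rightarrow> nat \<Rightarrow> bool" where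
  "admissible l u lam mu K i J j \<longleftrightarrow> K \<le> J + l \<and> J \<le> K + u \<and>
     (if K = 0 \<and> J = 0 then i \<le> j + (lam + mu) \<and> j \<le> i + (lam + mu)
      else if K = 0 then i \<le> j + lam \<and> j \<le> i + mu
      else if J = 0 then i \<le> j + mu \<and> j \<le> i + lam
      else i = j)"

lemma block_start_eq: "block_start m n K = (if K = 0 then 0 else m + (K - 1) * n)"
proof (induction K)
  case (Suc K)
  then show ?case by (cases K) (simp_all add: block_start_def block_size_def)
qed (simp add: block_start_def)

lemma block_coordinates_start:
  assumes "r < block_size m n K"
  shows "block_index m n (block_start m n K + r) = K"
    "block_offset m n (block_start m n K + r) = r"
  using assms
  by (cases K; simp add: block_index_def block_offset_def block_start_eq block_size_def)+

lemma block_coordinates: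
  assumes "i < m + p * n"
  shows "block_index m n i \<le> p"
    "block_offset m n i < block_size m n (block_index m n i)"
    "block_start m n (block_index m n i) + block_offset m n i = i"
proof -
  have "i - m < p * n" "n > 0" if "\<not> i < m"
    using that assms by (auto intro: gr0I)
  then show "block_index m n i \<le> p"
    "block_offset m n i < block_size m n (block_index m n i)"
    "block_start m n (block_index m n i) + block_offset m n i = i"
    by (auto simp: block_index_def block_offset_def block_start_eq block_size_def
        less_mult_imp_div_less Suc_le_eq)
qed

lemma block_index_mono: "i \<le> j \<Longrightarrow> block_index m n i \<le> block_index m n j"
  by (auto simp: block_index_def intro: div_le_mono)

text \<open>Every clause of the structure only forces certain entries to vanish, so all of them
  merge into one entrywise condition.\<close>

lemma B3_arrowhead_iff:
  "B3_arrowhead m n p l u lam mu A \<longleftrightarrow>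
     A \<in> carrier_mat (m + p * n) (m + p * n) \<and>
     (\<forall>K\<le>p. \<forall>J\<le>p. \<forall>i<block_size m n K. \<forall>j<block_size m n J.
        \<not> admissible l u lam mu K i J j \<longrightarrow>
          A $$ (block_start m n K + i, block_start m n J + j) = 0)"
    (is "?B \<longleftrightarrow> _ \<and> ?Z")
proof -
  define e where "e = (\<lambda>K J i j. A $$ (block_start m n K + i, block_start m n J + j))"
  have dim: "dim_row (block m n A K J) = block_size m n K"
    "dim_col (block m n A K J) = block_size m n J" for K J
    by (simp_all add: block_def)
  have entry: "block m n A K J $$ (i, j) = e K J i j"
    if "i < block_size m n K" "j < block_size m n J" for K J i j
    using that by (simp add: block_def e_def)
  have zero: "block m n A K J = 0\<^sub>m (block_size m n K) (block_size m n J) \<longleftrightarrow>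
      (\<forall>i<block_size m n K. \<forall>j<block_size m n J. e K J i j = 0)" for K J
    by (auto simp: mat_eq_iff dim entry)
  have band: "banded a b (block m n A K J) \<longleftrightarrow>
      (\<forall>i<block_size m n K. \<forall>j<block_size m n J. i > j + a \<or> j > i + b \<longrightarrow> e K J i j = 0)"
    for a b K J
  proof -
    have "int i - int j > int a \<longleftrightarrow> i > j + a" for i j a by linarith
    then show ?thesis by (simp add: banded_def dim entry)
  qed
  have diag: "diagonal_mat (block m n A K J) \<longleftrightarrow>
      (\<forall>i<block_size m n K. \<forall>j<block_size m n J. i \<noteq> j \<longrightarrow> e K J i j = 0)" for K J
    by (simp add: diagonal_mat_def dim entry)
  have far: "int K - int J > int a \<longleftrightarrow> K > J + a" for K J a by linarith
  have "?B \<longleftrightarrow> A \<in> carrier_mat (m + p * n) (m + p * n) \<and>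
      (\<forall>K\<le>p. \<forall>J\<le>p. K > J + l \<or> J > K + u \<longrightarrow>
        (\<forall>i<block_size m n K. \<forall>j<block_size m n J. e K J i j = 0)) \<and>
      (\<forall>i<block_size m n 0. \<forall>j<block_size m n 0.
        i > j + (lam + mu) \<or> j > i + (lam + mu) \<longrightarrow> e 0 0 i j = 0) \<and>
      (\<forall>k\<in>{1..p}. \<forall>i<block_size m n 0. \<forall>j<block_size m n k.
        i > j + lam \<or> j > i + mu \<longrightarrow> e 0 k i j = 0) \<and>
      (\<forall>k\<in>{1..p}. \<forall>i<block_size m n k. \<forall>j<block_size m n 0.
        i > j + mu \<or> j > i + lam \<longrightarrow> e k 0 i j = 0) \<and>
      (\<forall>K\<in>{1..p}. \<forall>J\<in>{1..p}. \<forall>i<block_size m n K. \<forall>j<block_size m n J.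
        i \<noteq> j \<longrightarrow> e K J i j = 0)"
    unfolding B3_arrowhead_def block_banded_def zero band diag far ..
  also have "\<dots> \<longleftrightarrow> A \<in> carrier_mat (m + p * n) (m + p * n) \<and>
     (\<forall>K\<le>p. \<forall>J\<le>p. \<forall>i<block_size m n K. \<forall>j<block_size m n J.
        \<not> admissible l u lam mu K i J j \<longrightarrow> e K J i j = 0)" (is "_ \<and> ?L \<longleftrightarrow> _ \<and> ?R")
  proof (intro conj_cong refl iffI)
    assume L: ?L
    show ?R
    proof (intro allI impI)
      fix K J i j
      assume "K \<le> p" "J \<le> p" "i < block_size m n K" "j < block_size m n J"
        "\<not> admissible l u lam mu K i J j"
      then show "e K J i j = 0"
        using L by (cases "K = 0"; cases "J = 0") (auto simp: admissible_def not_le)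
    qed
  next
    assume R: ?R
    show ?L
      by (intro conjI ballI allI impI; rule R[rule_format]) (auto simp: admissible_def)
  qed
  finally show ?thesis by (simp add: e_def)
qed

text \<open>The indicator matrix \<open>E\<close> of the admissible positions has the arrowhead
  structure and is nonzero at all of them at once; conversely, every arrowhead matrix vanishes
  elsewhere.\<close>

lemma structural_nonzeros_iff:
  "(i, j) \<in> structural_nonzeros m n p l u lam mu \<longleftrightarrow> i < m + p * n \<and> j < m + p * n \<and>
     admissible l u lam mu (block_index m n i) (block_offset m n i)
       (block_index m n j) (block_offset m n j)" (is "_ \<longleftrightarrow> _ \<and> _ \<and> ?adm i j")
proof (cases "i < m + p * n \<and> j < m + p * n")
  case True
  define E where "E = mat (m + p * n) (m + p * n) (\<lambda>(i, j). of_bool (?adm i j) :: real)"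
  have bound: "block_start m n K + r < m + p * n" if "K \<le> p" "r < block_size m n K" for K r
  proof (cases K)
    case (Suc K')
    have "Suc K' * n \<le> p * n" using that(1) Suc by (intro mult_right_mono) auto
    then show ?thesis using that(2) Suc by (simp add: block_start_eq block_size_def)
  qed (use that in \<open>simp add: block_start_eq block_size_def\<close>)
  have "B3_arrowhead m n p l u lam mu E"
    unfolding B3_arrowhead_iff by (simp add: E_def bound block_coordinates_start)
  then have "(i, j) \<in> structural_nonzeros m n p l u lam mu" if "?adm i j"
    using that True by (auto simp: structural_nonzeros_def E_def)
  moreover have "?adm i j" if "(i, j) \<in> structural_nonzeros m n p l u lam mu"
  proof (rule ccontr)
    assume nadm: "\<not> ?adm i j"
    obtain A where "B3_arrowhead m n p l u lam mu A" "A $$ (i, j) \<noteq> 0"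
      using \<open>(i, j) \<in> structural_nonzeros m n p l u lam mu\<close>
      by (auto simp: structural_nonzeros_def)
    then show False
      using nadm block_coordinates[of i m p n] block_coordinates[of j m p n] True
      unfolding B3_arrowhead_iff by metis
  qed
  ultimately show ?thesis using True by blast
qed (auto simp: structural_nonzeros_def)

definition lower_neighbours ::
    "nat \<Rightarrow> nat \<Rightarrow> nat \<Rightarrow> nat \<Rightarrow> nat \<Rightarrow> nat \<Rightarrow> nat \<Rightarrow> nat list" where
  "lower_neighbours m n p l lam mu k =
     filter (\<lambda>j. (k, j) \<in> structural_nonzeros m n p l l lam mu) [0..<k]"

text \<open>If \<open>i\<close> lies outside block 0, it has the offset of \<open>k\<close> and a
  block index between those of \<open>j\<close> and \<open>k\<close>, so what couples
  \<open>k\<close> to \<open>j\<close> also couples \<open>i\<close> to \<open>j\<close>. If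
  \<open>i\<close> lies in block 0, then so does \<open>j\<close>, and both lie within a distance
  \<open>lam + mu\<close> of each other.\<close>

lemma elimination_pattern_B3:
  "elimination_pattern (m + p * n) (lower_neighbours m n p l lam mu)"
proof
  fix k i j
  assume "k < m + p * n" "i \<in> set (lower_neighbours m n p l lam mu k)"
    "j \<in> set (lower_neighbours m n p l lam mu k)" "j < i"
  moreover from this have "block_index m n i \<le> block_index m n k"
    "block_index m n j \<le> block_index m n i"
    by (auto simp: lower_neighbours_def intro!: block_index_mono)
  ultimately show "j \<in> set (lower_neighbours m n p l lam mu i)"
    by (auto simp: lower_neighbours_def structural_nonzeros_iff admissible_def split: if_splits)
       (auto simp: block_index_def block_offset_def split: if_splits)
qed (auto simp: lower_neighbours_def)

text \<open>Outside block 0 there is at most one neighbour in each of the \<open>l\<close> preceding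
  blocks, plus a window of \<open>lam + mu + 1\<close> positions in block 0; inside block 0 there
  are at most \<open>lam + mu\<close>.\<close>

lemma length_lower_neighbours:
  assumes "k < m + p * n"
  shows "length (lower_neighbours m n p l lam mu k) \<le> l + lam + mu + 1"
proof -
  let ?K = "block_index m n k" and ?r = "block_offset m n k"
  let ?near = "(\<lambda>d. block_start m n (?K - d) + ?r) ` {1..l}"
  have "j \<in> ?near \<union> {?r - mu..?r + lam}"
    if "?K > 0" "j \<in> set (lower_neighbours m n p l lam mu k)" for j
  proof (cases "block_index m n j")
    case 0
    then have "block_offset m n j = j" by (auto simp: block_index_def block_offset_def split: if_splits)
    then show ?thesis using that 0
      by (auto simp: lower_neighbours_def structural_nonzeros_iff admissible_def)
  next
    case (Suc J)
    have "j \<le> k" using that(2) by (simp add: lower_neighbours_def)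
    then have "block_index m n j \<le> ?K" by (rule block_index_mono)
    then have j: "j < k" "block_index m n j \<le> ?K" "?K \<le> block_index m n j + l" "block_offset m n j = ?r"
      using that Suc
      by (auto simp: lower_neighbours_def structural_nonzeros_iff admissible_def)
    have start: "j = block_start m n (block_index m n j) + ?r"
      using block_coordinates(3)[of j m p n] j assms by simp
    \<comment> \<open>Block and offset determine the index, so the same block would force
      \<open>j = k\<close>; hence the distance is at least 1.\<close>
    moreover have "block_index m n j \<noteq> ?K"
      using start block_coordinates(3)[OF assms] j(1) by auto
    ultimately show ?thesis using j
      by (intro UnI1 image_eqI[of _ _ "?K - block_index m n j"]) auto
  qed
  moreover have "j \<in> {k - (lam + mu)..<k}"
    if "?K = 0" "j \<in> set (lower_neighbours m n p l lam mu k)" for j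
  proof -
    have "k < m" using that(1) by (auto simp: block_index_def split: if_splits)
    moreover have "j < k" using that(2) by (simp add: lower_neighbours_def)
    ultimately show ?thesis using that(2)
      by (auto simp: lower_neighbours_def structural_nonzeros_iff admissible_def
          block_index_def block_offset_def)
  qed
  moreover have "card (?near \<union> {?r - mu..?r + lam}) \<le> l + lam + mu + 1"
  proof -
    have "card ?near \<le> l" using card_image_le[of "{1..l}"] by simp
    moreover have "card {?r - mu..?r + lam} \<le> lam + mu + 1" by simp
    ultimately show ?thesis using card_Un_le[of ?near "{?r - mu..?r + lam}"] by linarith
  qed
  moreover have "card {k - (lam + mu)..<k} \<le> l + lam + mu + 1" by simp
  ultimately have "card (set (lower_neighbours m n p l lam mu k)) \<le> l + lam + mu + 1"
    by (cases "?K = 0") (meson card_mono finite_UnI finite_imageI finite_atLeastAtMost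
        finite_atLeastLessThan le_trans neq0_conv subsetI)+
  moreover have "distinct (lower_neighbours m n p l lam mu k)"
    by (simp add: lower_neighbours_def)
  ultimately show ?thesis by (simp add: distinct_card)
qed

section \<open>Sparsity of the factor and the linear complexity bound\<close>

section \<open>From functions to matrices\<close>

lemma symmetric_positive_definite_pos_def_on:
  assumes "symmetric_positive_definite A" "A \<in> carrier_mat N N"
  shows "pos_def_on N (\<lambda>i j. A $$ (i, j))"
  unfolding pos_def_on_def
proof (intro allI impI)
  fix x :: "nat \<Rightarrow> real"
  assume "\<exists>i<N. x i \<noteq> 0"
  then have "vec N x \<noteq> 0\<^sub>v N" by (metis index_vec index_zero_vec(1))
  then have "vec N x \<bullet> (A *\<^sub>v vec N x) > 0"
    using assms by (auto simp: symmetric_positive_definite_def)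
  also have "vec N x \<bullet> (A *\<^sub>v vec N x) = (\<Sum>i<N. \<Sum>j<N. x i * A $$ (i, j) * x j)"
    using assms(2)
    by (auto simp: scalar_prod_def atLeast0LessThan sum_distrib_left mult.assoc intro!: sum.cong)
  finally show "0 < (\<Sum>i<N. \<Sum>j<N. x i * A $$ (i, j) * x j)" .
qed

text \<open>Induction from the last row upwards. In the sum for \<open>a k j\<close> with
  \<open>j < k\<close>, terms \<open>r < k\<close> vanish by triangularity; terms
  \<open>r > k\<close> vanish by induction, since \<open>nbs_closed\<close> keeps
  \<open>(r, k)\<close> and \<open>(r, j)\<close> from both being in the pattern. What remains is
  \<open>L k k * L k j = 0\<close>.\<close>

lemma (in elimination_pattern) factor_zero_outside:
  assumes a: "\<And>i j. i < N \<Longrightarrow> j < N \<Longrightarrow> a i j = (\<Sum>k<N. L k i * L k j)"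
    and L: "\<And>i. i < N \<Longrightarrow> L i i > 0" "\<And>i j. i < j \<Longrightarrow> L i j = 0"
    and zero: "\<And>i j. i < N \<Longrightarrow> j < i \<Longrightarrow> (i, j) \<notin> pattern \<Longrightarrow> a i j = (0::real)"
    and "k < N" "(k, j) \<notin> pattern"
  shows "L k j = 0"
  using assms(5,6)
proof (induction "N - k" arbitrary: k j rule: less_induct)
  case less
  consider "k < j" | "j < k" using less.prems by (fastforce simp: pattern_def)
  then show ?case
  proof cases
    case 2
    have "L r k * L r j = 0" if r: "r < N" "r \<noteq> k" for r
    proof (cases "r < k")
      case False
      have "(r, k) \<notin> pattern \<or> (r, j) \<notin> pattern"
        using nbs_closed[OF r(1), of k j] less.prems 2 False r by (auto simp: pattern_def)
      then show ?thesis using less.hyps[of r] False r less.prems by auto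
    qed (use L in simp)
    then have "(\<Sum>r<N. L r k * L r j) = (\<Sum>r\<in>{k}. L r k * L r j)"
      using less.prems by (intro sum.mono_neutral_right) auto
    then have "L k k * L k j = 0" using a[of k j] zero[of k j] less.prems 2 by simp
    then show ?thesis using L(1)[of k] less.prems by simp
  qed (use L in simp)
qed

text \<open>The zeros of \<open>L\<close> extend the partial sums to full rows: the systems say that
  \<open>L\<close> maps \<open>x\<close> to \<open>y\<close> and its transpose maps \<open>y\<close>
  to \<open>b\<close>.\<close>

lemma solve_with_triangular_factor:
  assumes A: "A = (mat N N (\<lambda>(i, j). L i j))\<^sup>T * mat N N (\<lambda>(i, j). L i j)"
    and b: "b \<in> carrier_vec N"
    and lower: "\<And>i j. i < N \<Longrightarrow> i < j \<Longrightarrow> L i j = (0::real)"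
    and y: "\<And>k. k < N \<Longrightarrow> L k k * y k = b $ k - (\<Sum>r\<in>{k<..<N}. L r k * y r)"
    and x: "\<And>k. k < N \<Longrightarrow> L k k * x k = y k - (\<Sum>j<k. L k j * x j)"
  shows "A *\<^sub>v vec N x = b"
proof -
  let ?L = "mat N N (\<lambda>(i, j). L i j)"
  have split: "(\<Sum>j<N. f j) = (\<Sum>j<k. f j) + f k + (\<Sum>j\<in>{k<..<N}. f j)"
    if "k < N" for k and f :: "nat \<Rightarrow> real"
  proof -
    have "{..<N} = {..<k} \<union> insert k {k<..<N}" using that by auto
    then show ?thesis by (simp add: sum.union_disjoint disjoint_iff)
  qed
  have "?L *\<^sub>v vec N x = vec N y"
  proof (rule eq_vecI)
    fix k assume "k < dim_vec (vec N y)"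
    then have k: "k < N" by simp
    have "(\<Sum>j\<in>{k<..<N}. L k j * x j) = 0" using k by (intro sum.neutral) (auto simp: lower)
    then show "(?L *\<^sub>v vec N x) $ k = vec N y $ k"
      using k x[OF k] split[OF k, of "\<lambda>j. L k j * x j"]
      by (simp add: scalar_prod_def atLeast0LessThan)
  qed simp
  moreover have "?L\<^sup>T *\<^sub>v vec N y = b"
  proof (rule eq_vecI)
    fix k assume "k < dim_vec b"
    then have k: "k < N" using b by simp
    have "(\<Sum>r<k. L r k * y r) = 0" using k by (intro sum.neutral) (auto simp: lower)
    then show "(?L\<^sup>T *\<^sub>v vec N y) $ k = b $ k"
      using k y[OF k] split[OF k, of "\<lambda>r. L r k * y r"]
      by (simp add: scalar_prod_def atLeast0LessThan)
  qed (use b in simp)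
  ultimately show ?thesis
    unfolding A by (simp add: assoc_mult_mat_vec[of _ N N _ N])
qed

theorem corollary4p3:
  fixes l lam mu :: nat
  shows "\<exists>C::nat. \<forall>m n p :: nat. \<exists>factor_prog solve_prog :: program.
    length factor_prog \<le> C * (m + p * n) \<and>
    length solve_prog \<le> C * (m + p * n) \<and>
    (\<forall>A. B3_arrowhead m n p l l lam mu A \<and> symmetric_positive_definite A \<longrightarrow>
       (\<exists>F. computes_factor factor_prog (structural_nonzeros m n p l l lam mu) A F \<and>
          (\<forall>b\<in>carrier_vec (m + p * n). solves_with_factor solve_prog F A b)))"
proof -
  define c where "c = l + lam + mu + 1"
  \<comment> \<open>Dominates both \<open>1 + c + 2 * c * c\<close> for the factorisation and
    \<open>2 + 4 * c\<close> for the two sweeps.\<close>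
  define C where "C = 2 + 4 * c + 2 * c * c"
  show ?thesis
  proof (intro exI[of _ C] allI)
    fix m n p :: nat
    define N where "N = m + p * n"
    define S where "S = structural_nonzeros m n p l l lam mu"
    \<comment> \<open>This fixes both programs from the structure alone, before any matrix
      \<open>A\<close> is chosen.\<close>
    interpret elimination_pattern N "lower_neighbours m n p l lam mu"
      unfolding N_def by (rule elimination_pattern_B3)
    have nbs: "length (lower_neighbours m n p l lam mu k) \<le> c" if "k < N" for k
      using that unfolding N_def c_def by (rule length_lower_neighbours)
    have "length factor_prog \<le> C * N"
      by (rule order_trans[OF length_factor_prog[OF nbs] mult_right_mono]) (simp_all add: C_def)
    moreover have "length solve_prog \<le> C * N"
      by (rule order_trans[OF length_solve_prog[OF nbs] mult_right_mono]) (simp_all add: C_def)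
    moreover have "\<exists>F. computes_factor factor_prog S A F \<and>
        (\<forall>b\<in>carrier_vec N. solves_with_factor solve_prog F A b)"
      if B3: "B3_arrowhead m n p l l lam mu A" and spd: "symmetric_positive_definite A" for A
    proof -
      have carrier: "A \<in> carrier_mat N N" using B3 by (simp add: B3_arrowhead_def N_def)
      \<comment> \<open>Every matrix entry that the factorisation reads is among those
        loaded.\<close>
      have pattern_S: "pattern \<subseteq> S"
        unfolding pattern_def
        by (auto simp: S_def lower_neighbours_def structural_nonzeros_iff N_def admissible_def)
      have pattern_N: "i < N \<and> j < N" if "(i, j) \<in> pattern" for i j
        using that nbs_less by (fastforce simp: pattern_def)
      have sym: "A $$ (i, j) = A $$ (j, i)" if "i < N" "j < N" for i j
        using spd that carrier unfolding symmetric_positive_definite_def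
        by (metis carrier_matD index_transpose_mat(1))
      obtain L where L: "\<forall>i<N. L i i > 0" "\<forall>i j. i < j \<longrightarrow> L i j = 0"
        and A_eq: "\<forall>i<N. \<forall>j<N. A $$ (i, j) = (\<Sum>k<N. L k i * L k j)"
        using reverse_cholesky_exists[OF symmetric_positive_definite_pos_def_on[OF spd carrier] sym]
        by metis
      have factor: "A $$ (i, j) = (\<Sum>k<N. L k i * L k j)" if "i < N" "j < N" for i j
        using A_eq that by blast
      \<comment> \<open>A nonzero entry of \<open>A\<close> would itself witness that its position
        is structurally nonzero.\<close>
      have zero_A: "A $$ (i, j) = 0" if "i < N" "j < i" "(i, j) \<notin> pattern" for i j
        using that B3 unfolding pattern_def
        by (auto simp: lower_neighbours_def structural_nonzeros_def N_def)
      interpret pattern_factor N "lower_neighbours m n p l lam mu" L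
      proof
        show "L i j = 0" if "i < N" "(i, j) \<notin> pattern" for i j
          by (rule factor_zero_outside[of "\<lambda>i j. A $$ (i, j)" L, OF factor _ _ zero_A that])
             (use L in auto)
      qed (use L in blast)
      define F where "F = (\<lambda>(i, j). if (i, j) \<in> pattern then Some (L i j) else None)"
      have "to_mat N F = mat N N (\<lambda>(i, j). L i j)"
        by (rule eq_matI) (auto simp: to_mat_def F_def zero_outside)
      moreover have A: "A = (mat N N (\<lambda>(i, j). L i j))\<^sup>T * mat N N (\<lambda>(i, j). L i j)"
        using carrier
        by (intro eq_matI) (auto simp: factor scalar_prod_def atLeast0LessThan)
      ultimately have chol: "reverse_cholesky A (to_mat N F)"
        using carrier L by (simp add: reverse_cholesky_def lower_triangular_def)
      define s where "s = load (stored_at S A) (\<lambda>_. None)"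
      have "s (In_Mat i j) = Some (A $$ (i, j))" if "(i, j) \<in> pattern" for i j
        using that pattern_S by (auto simp: s_def load_def stored_at_def)
      moreover have "s (Out_Mat i j) = None" for i j by (simp add: s_def load_def)
      ultimately obtain s' where "run factor_prog s = Some s'"
        "\<forall>i j. s' (Out_Mat i j) = (if (i, j) \<in> pattern then Some (L i j) else None)"
        using run_factor_prog[of "\<lambda>i j. A $$ (i, j)" s, OF factor] by blast
      moreover from this(2) have "out_mat N s' = F"
        using pattern_N by (auto simp: out_mat_def F_def fun_eq_iff)
      ultimately have "computes_factor factor_prog S A F"
        using chol carrier by (auto simp: computes_factor_def s_def)
      moreover have "solves_with_factor solve_prog F A b" if b: "b \<in> carrier_vec N" for b
      proof -
        have nz: "\<And>i. i < N \<Longrightarrow> L i i \<noteq> 0" using L(1) by fastforce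
        obtain y where y: "\<And>k. k < N \<Longrightarrow> L k k * y k = b $ k - (\<Sum>r\<in>{k<..<N}. L r k * y r)"
          using upper_triangular_solution_exists[of N L "\<lambda>k. b $ k", OF nz] by blast
        obtain x where x: "\<And>k. k < N \<Longrightarrow> L k k * x k = y k - (\<Sum>j<k. L k j * x j)"
          using lower_triangular_solution_exists[of N L y, OF nz] by blast
        have "\<exists>s'. run solve_prog (load F (stored_vec b)) = Some s' \<and>
            (\<forall>j. s' (Out_Vec j) = (if j < N then Some (x j) else None))"
          using b y x
          by (intro run_solve_prog[where b = "\<lambda>k. b $ k" and y = y])
             (auto simp: load_def stored_vec_def F_def)
        then obtain s' where s': "run solve_prog (load F (stored_vec b)) = Some s'"
          "\<forall>j. s' (Out_Vec j) = (if j < N then Some (x j) else None)" by blast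
        have "A *\<^sub>v vec N x = b"
          by (rule solve_with_triangular_factor[OF A b lower y x])
        moreover have "out_vec N s' = stored_vec (vec N x)"
          using s'(2) by (auto simp: out_vec_def stored_vec_def)
        ultimately show ?thesis
          using s'(1) carrier unfolding solves_with_factor_def by (metis carrier_matD(2) vec_carrier)
      qed
      ultimately show ?thesis by blast
    qed
    ultimately show "\<exists>factor_prog solve_prog :: program.
      length factor_prog \<le> C * (m + p * n) \<and> length solve_prog \<le> C * (m + p * n) \<and>
      (\<forall>A. B3_arrowhead m n p l l lam mu A \<and> symmetric_positive_definite A \<longrightarrow>
         (\<exists>F. computes_factor factor_prog (structural_nonzeros m n p l l lam mu) A F \<and>
            (\<forall>b\<in>carrier_vec (m + p * n). solves_with_factor solve_prog F A b)))"
      unfolding N_def S_def by blast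
  qed
qed

end
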